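(* Let $C$ be a bivariate copula with $\phi(C)=\phi$. Then \[ 0\leqslant\mu_\infty(C)\leqslant\begin{cases}\dfrac{3+\sqrt{3+6\phi}}{12}, & \text{if } -\frac12\leqslant\phi\leqslant-\frac13,\\[2mm] \sqrt{\dfrac{1-\phi}{12}}, & \text{if } -\frac13\leqslant\phi\leqslant1,\end{cases} \] and the bounds are attained (for each $\phi\in[-\frac12,1]$, both the lower and the upper bound are attained by some copula $C$ with $\phi(C)=\phi$).
   Context: For a bivariate copula $C$, the measure of asymmetry is $\mu_\infty(C)=\max_{u,v\in[0,1]}|C(u,v)-C(v,u)|$. For copulas $C_1,C_2$ the concordance function is $\mathcal{Q}(C_1,C_2)=4\int_{[0,1]^2}C_2(u,v)\,dC_1(u,v)-1$. Spearman's footrule is $\phi(C)=\frac12\left(3\,\mathcal{Q}(C,M)-1\right)$, where $M(u,v)=\min\{u,v\}$; its range over all copulas is $[-\frac12,1]$. *)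

theory Defs
  imports "HOL-Probability.Probability"
begin

text \<open>Copulas are functions on the closed unit square. They are represented by curried
  functions on all pairs of reals whose values off the square are irrelevant: no definition
  below depends on them.\<close>

definition copula :: "(real \<Rightarrow> real \<Rightarrow> real) \<Rightarrow> bool" where
  "copula C \<longleftrightarrow>
     (\<forall>t\<in>{0..1}. C t 0 = 0 \<and> C 0 t = 0 \<and> C t 1 = t \<and> C 1 t = t) \<and>
     (\<forall>u1 u2 v1 v2. 0 \<le> u1 \<and> u1 \<le> u2 \<and> u2 \<le> 1 \<and> 0 \<le> v1 \<and> v1 \<le> v2 \<and> v2 \<le> 1 \<longrightarrow>
        C u2 v2 - C u1 v2 - C u2 v1 + C u1 v1 \<ge> 0)"

text \<open>The supremum is a maximum, since copulas are continuous on the compact unit square.\<close>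

definition mu_infty :: "(real \<Rightarrow> real \<Rightarrow> real) \<Rightarrow> real" where
  "mu_infty C = (SUP (u, v)\<in>{0..1} \<times> {0..1}. \<bar>C u v - C v u\<bar>)"

text \<open>The Borel probability measure \<open>dC\<close> with distribution function \<open>C\<close>. As \<open>C 1 1 = 1\<close> it is
  concentrated on the unit square, so for a copula it is uniquely determined.\<close>

definition copula_measure :: "(real \<Rightarrow> real \<Rightarrow> real) \<Rightarrow> (real \<times> real) measure" where
  "copula_measure C = (THE \<mu>. prob_space \<mu> \<and> sets \<mu> = sets borel \<and>
     (\<forall>u\<in>{0..1}. \<forall>v\<in>{0..1}. measure \<mu> ({0..u} \<times> {0..v}) = C u v))"

definition concordance :: "(real \<Rightarrow> real \<Rightarrow> real) \<Rightarrow> (real \<Rightarrow> real \<Rightarrow> real) \<Rightarrow> real" where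
  "concordance C1 C2 =
     4 * (LINT p:{0..1} \<times> {0..1}|copula_measure C1. C2 (fst p) (snd p)) - 1"

definition copula_M :: "real \<Rightarrow> real \<Rightarrow> real" where
  "copula_M u v = min u v"

definition footrule :: "(real \<Rightarrow> real \<Rightarrow> real) \<Rightarrow> real" where
  "footrule C = 1 / 2 * (3 * concordance C copula_M - 1)"

end

theory Submission imports Defs begin

text \<open>Fubini's theorem gives \<open>footrule C = 6 * I - 2\<close> with \<open>I\<close> the integral of \<open>C t t\<close> over \<open>[0, 1]\<close>. If
  \<open>d = C a b - C b a \<ge> 0\<close> with \<open>a \<le> b\<close>, then monotonicity and the Lipschitz property of \<open>C\<close> bound the
  diagonal by piecewise affine functions, and integration yields
  \<open>I \<le> 1 / 2 - 2 * d\<^sup>2\<close> and, for \<open>d \<ge> 1 / 4\<close>, \<open>I \<ge> 4 * d\<^sup>2 - 2 * d + 1 / 2\<close>. Suitable shuffles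
  of \<open>min\<close> give equality.

  That a copula is the distribution function of a measure is shown by a bisection argument.
  Nested subintervals of \<open>[0, 1)\<close> are assigned to the nested dyadic rectangles, the length of an
  interval being the \<open>C\<close>-volume of its rectangle; a uniformly distributed point then
  selects a nested sequence of rectangles, whose intersection is a random point with law \<open>dC\<close>.\<close>

section \<open>Random words from a consistent mass on the binary tree\<close>

locale mass_tree =
  fixes m :: "bool list \<Rightarrow> real"
  assumes mass_Nil: "m [] = 1"
    and mass_nonneg: "0 \<le> m w"
    and mass_split: "m w = m (False # w) + m (True # w)"
begin

text \<open>The left end of the interval assigned to a word; its length is \<open>m w\<close>. The
  \<open>False\<close> child keeps the left end, and the \<open>True\<close> child starts where the
  \<open>False\<close> child stops.\<close>

fun pos :: "bool list \<Rightarrow> real" where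
  "pos [] = 0"
| "pos (b # w) = pos w + (if b then m (False # w) else 0)"

fun word :: "nat \<Rightarrow> real \<Rightarrow> bool list" where
  "word 0 \<omega> = []"
| "word (Suc n) \<omega> = (pos (True # word n \<omega>) \<le> \<omega>) # word n \<omega>"

lemma length_word [simp]: "length (word n \<omega>) = n"
  by (induction n) auto

text \<open>The half-open interval of a word is the disjoint union of those of its two children, and
  \<open>word\<close> compares \<omega> with their common end. A child of mass 0 has an empty
  interval and is never selected.\<close>

lemma word_eq_iff:
  assumes "0 \<le> \<omega>" "\<omega> < 1"
  shows "word (length w) \<omega> = w \<longleftrightarrow> pos w \<le> \<omega> \<and> \<omega> < pos w + m w"
proof (induction w)
  case Nil
  then show ?case using assms by (simp add: mass_Nil)
next
  case (Cons b w)
  then show ?case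
    using mass_split[of w] mass_nonneg[of "True # w"] mass_nonneg[of "False # w"] by auto
qed

lemma measurable_word [measurable]: "word n \<in> borel \<rightarrow>\<^sub>M count_space UNIV"
proof (induction n)
  case (Suc n)
  \<comment> \<open>The next bit depends on \<omega> directly and through the earlier bits; since
    words are countable, each fixed value of the earlier bits can be treated separately.\<close>
  have "(\<lambda>\<omega>. (\<lambda>w x. (pos (True # w) \<le> x) # w) (word n \<omega>) \<omega>) \<in> borel \<rightarrow>\<^sub>M count_space UNIV"
  proof (rule measurable_compose_countable[OF _ Suc])
    fix w
    have "(\<lambda>x. if pos (True # w) \<le> x then True # w else False # w)
            \<in> borel \<rightarrow>\<^sub>M count_space UNIV"
      by measurable
    then show "(\<lambda>x. (pos (True # w) \<le> x) # w) \<in> borel \<rightarrow>\<^sub>M count_space UNIV"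
      by (rule measurable_cong[THEN iffD1, rotated]) auto
  qed
  then show ?case by simp
qed simp

abbreviation unif :: "real measure" where
  "unif \<equiv> uniform_measure lborel {0..<1}"

lemma prob_space_unif: "prob_space unif"
  by (rule prob_space_uniform_measure) auto

lemma measure_word:
  "measure unif {\<omega>. word (length w) \<omega> = w} = m w"
proof -
  have "{\<omega>. word (length w) \<omega> = w} \<in> sets borel"
    using measurable_sets[OF measurable_word, of "{w}" "length w"] by (simp add: vimage_def)
  then have "measure unif {\<omega>. word (length w) \<omega> = w}
      = measure lborel ({0..<1} \<inter> {\<omega>. word (length w) \<omega> = w})"
    by (subst measure_uniform_measure) auto
  also have "{0..<1} \<inter> {\<omega>. word (length w) \<omega> = w} = {0..<1} \<inter> {pos w..<pos w + m w}"
    using word_eq_iff by auto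
  also have "{0..<1} \<inter> {pos w..<pos w + m w} = {pos w..<pos w + m w}"
  proof -
    have "0 \<le> pos w \<and> pos w + m w \<le> 1"
    proof (induction w)
      case (Cons b w)
      then show ?case
        using mass_split[of w] mass_nonneg[of "True # w"] mass_nonneg[of "False # w"] by auto
    qed (simp add: mass_Nil)
    then show ?thesis by auto
  qed
  finally show ?thesis using mass_nonneg[of w] by simp
qed

lemma measure_word_in:
  assumes "\<And>w. w \<in> S \<Longrightarrow> length w = n"
  shows "measure unif {\<omega>. word n \<omega> \<in> S} = sum m S"
proof -
  interpret prob_space unif by (rule prob_space_unif)
  have fin: "finite S"
    by (rule finite_subset[OF _ finite_lists_length_eq[of UNIV n]]) (use assms in auto)
  have "{\<omega>. word n \<omega> \<in> S} = (\<Union>w\<in>S. {\<omega>. word n \<omega> = w})" by auto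
  also have "measure unif \<dots> = (\<Sum>w\<in>S. measure unif {\<omega>. word n \<omega> = w})"
  proof (rule finite_measure_finite_Union[OF fin])
    show "(\<lambda>w. {\<omega>. word n \<omega> = w}) ` S \<subseteq> events"
      using measurable_sets[OF measurable_word, of "{w}" n for w] by (auto simp: vimage_def)
  qed (auto simp: disjoint_family_on_def)
  also have "\<dots> = sum m S"
    using assms measure_word by (intro sum.cong) auto
  finally show ?thesis .
qed

end

lemma sum_lists_length_Suc:
  fixes f :: "bool list \<Rightarrow> real"
  shows "(\<Sum>w | length w = Suc n. f w) = (\<Sum>w | length w = n. f (False # w) + f (True # w))"
proof -
  have fin: "finite {w :: bool list. length w = n}"
    using finite_lists_length_eq[of "UNIV :: bool set" n] by simp
  have "{w. length w = Suc n} = (#) False ` {w. length w = n} \<union> (#) True ` {w. length w = n}"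
    by (auto simp: length_Suc_conv image_iff)
  then have "(\<Sum>w | length w = Suc n. f w)
      = sum f ((#) False ` {w. length w = n}) + sum f ((#) True ` {w. length w = n})"
    using fin by (subst sum.union_disjoint[symmetric]) auto
  also have "\<dots> = (\<Sum>w | length w = n. f (False # w)) + (\<Sum>w | length w = n. f (True # w))"
    by (subst (1 2) sum.reindex) (auto simp: inj_on_def)
  finally show ?thesis by (simp add: sum.distrib)
qed

section \<open>Elementary inequalities for copulas\<close>

locale copula_fun =
  fixes C :: "real \<Rightarrow> real \<Rightarrow> real"
  assumes copula: "copula C"
begin

lemma margins:
  assumes "0 \<le> t" "t \<le> 1"
  shows "C t 0 = 0" "C 0 t = 0" "C t 1 = t" "C 1 t = t"
  using copula assms unfolding copula_def by auto

lemma two_increasing: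
  assumes "0 \<le> u1" "u1 \<le> u2" "u2 \<le> 1" "0 \<le> v1" "v1 \<le> v2" "v2 \<le> 1"
  shows "0 \<le> C u2 v2 - C u1 v2 - C u2 v1 + C u1 v1"
  using copula assms unfolding copula_def by auto

text \<open>A rectangle with a side on the edge \<open>v = 0\<close> gives monotonicity; one with a
  side on the edge \<open>v = 1\<close> gives the Lipschitz bound.\<close>

lemma increment_left:
  assumes "0 \<le> u1" "u1 \<le> u2" "u2 \<le> 1" "0 \<le> v" "v \<le> 1"
  shows "C u1 v \<le> C u2 v" "C u2 v \<le> C u1 v + (u2 - u1)"
  using two_increasing[of u1 u2 0 v] two_increasing[of u1 u2 v 1] assms margins[of u1] margins[of u2]
  by auto

lemma increment_right:
  assumes "0 \<le> u" "u \<le> 1" "0 \<le> v1" "v1 \<le> v2" "v2 \<le> 1"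
  shows "C u v1 \<le> C u v2" "C u v2 \<le> C u v1 + (v2 - v1)"
  using two_increasing[of 0 u v1 v2] two_increasing[of u 1 v1 v2] assms margins[of v1] margins[of v2]
  by auto

lemma frechet_bounds:
  assumes "0 \<le> u" "u \<le> 1" "0 \<le> v" "v \<le> 1"
  shows "0 \<le> C u v" "C u v \<le> u" "C u v \<le> v" "u + v - 1 \<le> C u v"
  using increment_left[of 0 u v] increment_right[of u 0 v] increment_left[of u 1 v] assms
    margins[of u] margins[of v] by auto

text \<open>Clipping turns \<open>C\<close> into a distribution function on the whole plane, so that
  corners may be shifted outside the unit square.\<close>

definition ext :: "real \<Rightarrow> real \<Rightarrow> real" where
  "ext u v = C (max 0 (min 1 u)) (max 0 (min 1 v))"

lemma ext_eq: "0 \<le> u \<Longrightarrow> u \<le> 1 \<Longrightarrow> 0 \<le> v \<Longrightarrow> v \<le> 1 \<Longrightarrow> ext u v = C u v"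
  by (simp add: ext_def min_absorb2 max_absorb2)

lemma ext_eq_0: "u \<le> 0 \<or> v \<le> 0 \<Longrightarrow> ext u v = 0"
  by (auto simp: ext_def margins min_def max_def)

lemma ext_min_1: "ext (min 1 u) v = ext u v" "ext u (min 1 v) = ext u v"
  by (simp_all add: ext_def)

section \<open>Volumes of rectangles under dyadic bisection\<close>

definition vol :: "real \<Rightarrow> real \<Rightarrow> real \<Rightarrow> real \<Rightarrow> real" where
  "vol u1 u2 v1 v2 = ext u2 v2 - ext u1 v2 - ext u2 v1 + ext u1 v1"

lemma vol_nonneg: "u1 \<le> u2 \<Longrightarrow> v1 \<le> v2 \<Longrightarrow> 0 \<le> vol u1 u2 v1 v2"
  unfolding vol_def ext_def by (rule two_increasing) auto

lemma ext_add_le: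
  assumes "0 \<le> h"
  shows "ext (u + h) (v + h) \<le> ext u v + 2 * h"
proof -
  let ?c = "\<lambda>x::real. max 0 (min 1 x)"
  have "?c u \<le> ?c (u + h)" "?c v \<le> ?c (v + h)" "?c (u + h) - ?c u \<le> h" "?c (v + h) - ?c v \<le> h"
    using assms by (auto simp: min_def max_def)
  then show ?thesis
    using increment_left(2)[of "?c u" "?c (u + h)" "?c (v + h)"]
      increment_right(2)[of "?c u" "?c v" "?c (v + h)"]
    unfolding ext_def by force
qed

lemma vol_mono:
  assumes "u1 \<le> u1'" "u1' \<le> u2'" "u2' \<le> u2" "v1 \<le> v1'" "v1' \<le> v2'" "v2' \<le> v2"
  shows "vol u1' u2' v1' v2' \<le> vol u1 u2 v1 v2"
proof -
  have "v1 \<le> v2" using assms by simp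
  then have "0 \<le> vol u1 u1' v1 v2" "0 \<le> vol u2' u2 v1 v2"
    "0 \<le> vol u1' u2' v1 v1'" "0 \<le> vol u1' u2' v2' v2"
    using assms by (intro vol_nonneg; simp)+
  then show ?thesis unfolding vol_def by linarith
qed

text \<open>Words of length \<open>n\<close> index the dyadic rectangles obtained from the unit square by \<open>n\<close>
  bisections, alternately of the first and of the second coordinate. The most recent bit
  is the head of the word.\<close>

fun lo1 hi1 lo2 hi2 :: "bool list \<Rightarrow> real" where
  "lo1 [] = 0"
| "lo1 (b # w) = (if even (length w) \<and> b then (lo1 w + hi1 w) / 2 else lo1 w)"
| "hi1 [] = 1"
| "hi1 (b # w) = (if even (length w) \<and> \<not> b then (lo1 w + hi1 w) / 2 else hi1 w)"
| "lo2 [] = 0"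
| "lo2 (b # w) = (if odd (length w) \<and> b then (lo2 w + hi2 w) / 2 else lo2 w)"
| "hi2 [] = 1"
| "hi2 (b # w) = (if odd (length w) \<and> \<not> b then (lo2 w + hi2 w) / 2 else hi2 w)"

lemma width:
  "hi1 w - lo1 w = (1 / 2) ^ ((length w + 1) div 2)"
  "hi2 w - lo2 w = (1 / 2) ^ (length w div 2)"
proof -
  have "hi1 w - lo1 w = (1 / 2) ^ ((length w + 1) div 2) \<and> hi2 w - lo2 w = (1 / 2) ^ (length w div 2)"
  proof (induction w)
    case (Cons b w)
    show ?case
    proof (cases "even (length w)")
      case True
      then obtain k where "length w = 2 * k" by (elim evenE)
      then show ?thesis using Cons by (cases b) (simp_all add: field_simps)
    next
      case False
      then obtain k where "length w = 2 * k + 1" by (elim oddE)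
      then show ?thesis using Cons by (cases b) (simp_all add: field_simps)
    qed
  qed simp
  then show "hi1 w - lo1 w = (1 / 2) ^ ((length w + 1) div 2)"
    "hi2 w - lo2 w = (1 / 2) ^ (length w div 2)" by simp_all
qed

lemma lo_le_hi: "lo1 w \<le> hi1 w" "lo2 w \<le> hi2 w"
proof -
  have "0 \<le> hi1 w - lo1 w" "0 \<le> hi2 w - lo2 w" by (simp_all only: width) simp_all
  then show "lo1 w \<le> hi1 w" "lo2 w \<le> hi2 w" by simp_all
qed

definition mass :: "bool list \<Rightarrow> real" where
  "mass w = vol (lo1 w) (hi1 w) (lo2 w) (hi2 w)"

text \<open>The \<open>C\<close>-volume of the part of the rectangle of \<open>w\<close> below and
  to the left of \<open>(u, v)\<close>. If there is no such part, two opposite sides coincide after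
  clipping and the volume is 0.\<close>

definition cut_mass :: "real \<Rightarrow> real \<Rightarrow> bool list \<Rightarrow> real" where
  "cut_mass u v w = vol (min u (lo1 w)) (min u (hi1 w)) (min v (lo2 w)) (min v (hi2 w))"

sublocale mass_tree mass
proof
  show "mass [] = 1" by (simp add: mass_def vol_def ext_eq margins)
  show "0 \<le> mass w" for w unfolding mass_def by (intro vol_nonneg lo_le_hi)
  show "mass w = mass (False # w) + mass (True # w)" for w
    by (auto simp: mass_def vol_def)
qed

lemma cut_mass_nonneg: "0 \<le> cut_mass u v w"
  unfolding cut_mass_def using lo_le_hi[of w] by (intro vol_nonneg) (auto simp: min_def)

lemma cut_mass_le: "cut_mass u v w \<le> mass w"
proof -
  \<comment> \<open>One coordinate is cut at a time: either the cut rectangle degenerates, or it is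
    contained in the original one.\<close>
  have a: "vol (min u (lo1 w)) (min u (hi1 w)) p q \<le> vol (lo1 w) (hi1 w) p q" if "p \<le> q" for p q
    using lo_le_hi[of w] vol_mono[of "lo1 w" "lo1 w" "min u (hi1 w)" "hi1 w" p p q q]
      vol_nonneg[of "lo1 w" "hi1 w" p q] that
    by (cases "u \<le> lo1 w") (auto simp: vol_def min_def)
  have b: "vol p q (min v (lo2 w)) (min v (hi2 w)) \<le> vol p q (lo2 w) (hi2 w)" if "p \<le> q" for p q
    using lo_le_hi[of w] vol_mono[of p p q q "lo2 w" "lo2 w" "min v (hi2 w)" "hi2 w"]
      vol_nonneg[of p q "lo2 w" "hi2 w"] that
    by (cases "v \<le> lo2 w") (auto simp: vol_def min_def)
  have "min v (lo2 w) \<le> min v (hi2 w)" using lo_le_hi[of w] by (auto simp: min_def)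
  then show ?thesis unfolding cut_mass_def mass_def
    using a b[of "lo1 w" "hi1 w"] lo_le_hi[of w] order.trans by blast
qed

lemma cut_mass_eq_0: "u \<le> lo1 w \<or> v \<le> lo2 w \<Longrightarrow> cut_mass u v w = 0"
  using lo_le_hi[of w] unfolding cut_mass_def vol_def by (auto simp: min_def)

lemma cut_mass_eq: "hi1 w \<le> u \<Longrightarrow> hi2 w \<le> v \<Longrightarrow> cut_mass u v w = mass w"
  using lo_le_hi[of w] unfolding cut_mass_def mass_def by (simp add: min_absorb2)

text \<open>Bisection preserves the total, so only the empty word has to be evaluated; there the
  lower sides lie at or below 0, where \<open>ext\<close> vanishes.\<close>

lemma sum_cut_mass: "(\<Sum>w | length w = n. cut_mass u v w) = ext u v"
proof (induction n)
  case 0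
  have "{w :: bool list. length w = 0} = {[]}" by auto
  moreover have "ext (min u 0) p = 0" "ext p (min v 0) = 0" for p
    by (auto intro!: ext_eq_0)
  ultimately show ?case
    by (simp add: cut_mass_def vol_def min.commute[of _ 1] ext_min_1)
next
  case (Suc n)
  have "cut_mass u v (False # w) + cut_mass u v (True # w) = cut_mass u v w" for w
    by (auto simp: cut_mass_def vol_def)
  then show ?case using Suc by (simp add: sum_lists_length_Suc)
qed

section \<open>The random point and its law\<close>

definition coord1 :: "real \<Rightarrow> real" where
  "coord1 \<omega> = (SUP n. lo1 (word n \<omega>))"

definition coord2 :: "real \<Rightarrow> real" where
  "coord2 \<omega> = (SUP n. lo2 (word n \<omega>))"

lemma hi_word_antimono:
  "i \<le> j \<Longrightarrow> hi1 (word j \<omega>) \<le> hi1 (word i \<omega>)"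
  "i \<le> j \<Longrightarrow> hi2 (word j \<omega>) \<le> hi2 (word i \<omega>)"
proof -
  have "hi1 (word (Suc n) \<omega>) \<le> hi1 (word n \<omega>)" "hi2 (word (Suc n) \<omega>) \<le> hi2 (word n \<omega>)" for n
    using lo_le_hi[of "word n \<omega>"] by auto
  then show "i \<le> j \<Longrightarrow> hi1 (word j \<omega>) \<le> hi1 (word i \<omega>)"
    "i \<le> j \<Longrightarrow> hi2 (word j \<omega>) \<le> hi2 (word i \<omega>)"
    by (auto intro: lift_Suc_antimono_le[of "\<lambda>n. hi1 (word n \<omega>)"]
        lift_Suc_antimono_le[of "\<lambda>n. hi2 (word n \<omega>)"])
qed

lemma lo_word_mono:
  "i \<le> j \<Longrightarrow> lo1 (word i \<omega>) \<le> lo1 (word j \<omega>)"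
  "i \<le> j \<Longrightarrow> lo2 (word i \<omega>) \<le> lo2 (word j \<omega>)"
proof -
  have "lo1 (word n \<omega>) \<le> lo1 (word (Suc n) \<omega>)" "lo2 (word n \<omega>) \<le> lo2 (word (Suc n) \<omega>)" for n
    using lo_le_hi[of "word n \<omega>"] by auto
  then show "i \<le> j \<Longrightarrow> lo1 (word i \<omega>) \<le> lo1 (word j \<omega>)"
    "i \<le> j \<Longrightarrow> lo2 (word i \<omega>) \<le> lo2 (word j \<omega>)"
    by (auto intro: lift_Suc_mono_le[of "\<lambda>n. lo1 (word n \<omega>)"]
        lift_Suc_mono_le[of "\<lambda>n. lo2 (word n \<omega>)"])
qed

lemma lo_word_le_hi_word:
  "lo1 (word i \<omega>) \<le> hi1 (word j \<omega>)" "lo2 (word i \<omega>) \<le> hi2 (word j \<omega>)"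
proof -
  let ?k = "max i j"
  show "lo1 (word i \<omega>) \<le> hi1 (word j \<omega>)"
    using lo_word_mono(1)[of i ?k \<omega>] hi_word_antimono(1)[of j ?k \<omega>] lo_le_hi(1)[of "word ?k \<omega>"]
    by simp
  show "lo2 (word i \<omega>) \<le> hi2 (word j \<omega>)"
    using lo_word_mono(2)[of i ?k \<omega>] hi_word_antimono(2)[of j ?k \<omega>] lo_le_hi(2)[of "word ?k \<omega>"]
    by simp
qed

lemma bdd_above_lo_word:
  "bdd_above (range (\<lambda>n. lo1 (word n \<omega>)))" "bdd_above (range (\<lambda>n. lo2 (word n \<omega>)))"
  using lo_word_le_hi_word[where j = 0] by (auto intro!: bdd_aboveI[where M = 1])

text \<open>Lower ends never exceed upper ends, even at different levels, so the suprema of the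
  lower ends give a point of every closed rectangle in the nested sequence.\<close>

lemma coord_bounds:
  "lo1 (word n \<omega>) \<le> coord1 \<omega>" "coord1 \<omega> \<le> hi1 (word n \<omega>)"
  "lo2 (word n \<omega>) \<le> coord2 \<omega>" "coord2 \<omega> \<le> hi2 (word n \<omega>)"
  unfolding coord1_def coord2_def
  using bdd_above_lo_word lo_word_le_hi_word by (auto intro: cSUP_upper cSUP_least)

lemma coord_measurable [measurable]:
  "coord1 \<in> borel_measurable borel" "coord2 \<in> borel_measurable borel"
proof -
  have "(\<lambda>\<omega>. f (word n \<omega>)) \<in> borel_measurable borel" for n and f :: "bool list \<Rightarrow> real"
    by (rule measurable_compose[OF measurable_word]) simp
  then show "coord1 \<in> borel_measurable borel" "coord2 \<in> borel_measurable borel"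
    unfolding coord1_def coord2_def using bdd_above_lo_word
    by (auto intro!: borel_measurable_cSUP)
qed

text \<open>At level \<open>2 * k\<close> all rectangles are squares of side \<open>h\<close>. The
  squares \<open>S\<close> inside the quadrant below \<open>(u, v)\<close> bound the event from
  within, and the squares \<open>T\<close> with lower left corner in it bound the event from
  outside. The probability is thus squeezed between \<open>ext\<close> at
  \<open>(u - h, v - h)\<close> and at \<open>(u + h, v + h)\<close>.\<close>

lemma prob_coord:
  "measure unif {\<omega>. coord1 \<omega> \<le> u \<and> coord2 \<omega> \<le> v} = ext u v"
proof -
  interpret prob_space unif by (rule prob_space_unif)
  let ?A = "{\<omega>. coord1 \<omega> \<le> u \<and> coord2 \<omega> \<le> v}"
  have A: "?A \<in> events" by simp
  have fin: "finite {w :: bool list. length w = n}" for n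
    using finite_lists_length_eq[of "UNIV :: bool set" n] by simp
  have close: "\<bar>measure unif ?A - ext u v\<bar> \<le> 2 * (1 / 2) ^ k" for k
  proof -
    define h :: real where "h = (1 / 2) ^ k"
    define S where "S = {w. length w = 2 * k \<and> hi1 w \<le> u \<and> hi2 w \<le> v}"
    define T where "T = {w. length w = 2 * k \<and> lo1 w \<le> u \<and> lo2 w \<le> v}"
    have wid: "hi1 w = lo1 w + h" "hi2 w = lo2 w + h" if "length w = 2 * k" for w
      using width[of w] that by (auto simp: h_def)
    have ev: "{\<omega>. word (2 * k) \<omega> \<in> U} \<in> events" for U
      using measurable_sets[OF measurable_word, of U "2 * k"] by (simp add: vimage_def)
    have "ext (u - h) (v - h) = (\<Sum>w | length w = 2 * k. cut_mass (u - h) (v - h) w)"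
      by (simp add: sum_cut_mass)
    \<comment> \<open>A square outside \<open>S\<close> sticks out beyond \<open>u\<close> or
      \<open>v\<close>, so its lower side in that coordinate exceeds \<open>u - h\<close> or
      \<open>v - h\<close> and the shrunken quadrant cuts off nothing.\<close>
    also have "\<dots> = sum (cut_mass (u - h) (v - h)) S"
      by (rule sum.mono_neutral_right[OF fin])
        (auto simp: S_def wid intro!: cut_mass_eq_0)
    also have "\<dots> \<le> sum mass S" by (intro sum_mono cut_mass_le)
    also have "\<dots> = measure unif {\<omega>. word (2 * k) \<omega> \<in> S}"
      by (rule measure_word_in[symmetric]) (simp add: S_def)
    also have "\<dots> \<le> measure unif ?A"
      using order.trans[OF coord_bounds(2)] order.trans[OF coord_bounds(4)]
      by (intro finite_measure_mono[OF _ A]) (auto simp: S_def)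
    finally have 1: "ext (u - h) (v - h) \<le> measure unif ?A" .
    have "measure unif ?A \<le> measure unif {\<omega>. word (2 * k) \<omega> \<in> T}"
      using order.trans[OF coord_bounds(1)] order.trans[OF coord_bounds(3)]
      by (intro finite_measure_mono[OF _ ev]) (auto simp: T_def)
    also have "\<dots> = sum mass T"
      by (rule measure_word_in) (simp add: T_def)
    also have "\<dots> = sum (cut_mass (u + h) (v + h)) T"
      by (intro sum.cong refl cut_mass_eq[symmetric]) (auto simp: T_def wid)
    also have "\<dots> \<le> (\<Sum>w | length w = 2 * k. cut_mass (u + h) (v + h) w)"
      by (rule sum_mono2[OF fin]) (auto simp: T_def cut_mass_nonneg)
    also have "\<dots> = ext (u + h) (v + h)" by (rule sum_cut_mass)
    finally have 2: "measure unif ?A \<le> ext (u + h) (v + h)" .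
    have "0 \<le> h" by (simp add: h_def)
    then show ?thesis
      using 1 2 ext_add_le[of h u v] ext_add_le[of h "u - h" "v - h"] by (simp add: h_def[symmetric])
  qed
  have "(\<lambda>k. 2 * (1 / 2) ^ k :: real) \<longlonglongrightarrow> 2 * 0"
    by (intro tendsto_intros LIMSEQ_realpow_zero) auto
  from LIMSEQ_le_const[OF this, of "\<bar>measure unif ?A - ext u v\<bar>"] close
  have "\<bar>measure unif ?A - ext u v\<bar> \<le> 0" by simp
  then show ?thesis by simp
qed

section \<open>Existence and uniqueness of the measure dC\<close>

definition copula_law :: "(real \<times> real) measure \<Rightarrow> bool" where
  "copula_law \<mu> \<longleftrightarrow> prob_space \<mu> \<and> sets \<mu> = sets borel \<and>
     (\<forall>u\<in>{0..1}. \<forall>v\<in>{0..1}. measure \<mu> ({0..u} \<times> {0..v}) = C u v)"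

lemma copula_law_exists: "copula_law (distr unif borel (\<lambda>\<omega>. (coord1 \<omega>, coord2 \<omega>)))"
  (is "copula_law ?\<mu>")
proof -
  interpret prob_space unif by (rule prob_space_unif)
  have meas: "(\<lambda>\<omega>. (coord1 \<omega>, coord2 \<omega>)) \<in> unif \<rightarrow>\<^sub>M borel"
    by (simp add: borel_prod[symmetric])
  have "measure ?\<mu> ({0..u} \<times> {0..v}) = C u v" if "u \<in> {0..1}" "v \<in> {0..1}" for u v
  proof -
    have "0 \<le> coord1 \<omega>" "0 \<le> coord2 \<omega>" for \<omega>
      using coord_bounds(1,3)[where n = 0 and \<omega> = \<omega>] by simp_all
    then have "(\<lambda>\<omega>. (coord1 \<omega>, coord2 \<omega>)) -` ({0..u} \<times> {0..v}) \<inter> space unif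
        = {\<omega>. coord1 \<omega> \<le> u \<and> coord2 \<omega> \<le> v}"
      by auto
    then show ?thesis
      using that by (subst measure_distr[OF meas])
        (auto simp: borel_prod[symmetric] prob_coord ext_eq)
  qed
  then show ?thesis
    unfolding copula_law_def using prob_space_distr[OF meas] by simp
qed

text \<open>As \<open>C 1 1 = 1\<close>, almost all mass lies in the unit square, so a quadrant and
  its clipped box differ by a null set. Quadrants form an intersection-stable generator of the Borel
  sets, which yields uniqueness.\<close>

lemma measure_atMost_copula_law:
  assumes "copula_law \<mu>"
  shows "measure \<mu> {..(u, v)} = ext u v"
proof -
  interpret prob_space \<mu> using assms by (simp add: copula_law_def)
  have sets [measurable_cong]: "sets \<mu> = sets borel" using assms by (simp add: copula_law_def)
  have box: "closed ({a..b} \<times> {c..d})" for a b c d :: real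
    by (intro closed_Times closed_atLeastAtMost)
  have ev: "{a..b} \<times> {c..d} \<in> events" for a b c d :: real
    unfolding sets using box by (rule borel_closed)
  have "prob ({0..1} \<times> {0..1}) = 1"
    using assms margins(3)[of 1] by (simp add: copula_law_def)
  then have ae: "AE p in \<mu>. p \<in> {0..1} \<times> {0..1}" using ev prob_eq_1 by blast
  show ?thesis
  proof (cases "0 \<le> u \<and> 0 \<le> v")
    case True
    have "prob {..(u, v)} = prob ({0..min 1 u} \<times> {0..min 1 v})"
    proof (rule measure_eq_AE)
      show "AE p in \<mu>. p \<in> {..(u, v)} \<longleftrightarrow> p \<in> {0..min 1 u} \<times> {0..min 1 v}"
        using ae by eventually_elim (auto simp: less_eq_prod_def)
    qed (use ev in \<open>auto simp: sets\<close>)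
    then show ?thesis using assms True by (simp add: copula_law_def ext_def)
  next
    case False
    have "prob {..(u, v)} = prob {}"
    proof (rule measure_eq_AE)
      show "AE p in \<mu>. p \<in> {..(u, v)} \<longleftrightarrow> p \<in> {}"
        using ae by eventually_elim (use False in \<open>auto simp: less_eq_prod_def\<close>)
    qed (auto simp: sets)
    then show ?thesis using False ext_eq_0[of u v] by auto
  qed
qed

lemma copula_law_unique:
  assumes "copula_law \<mu>" "copula_law \<nu>"
  shows "\<mu> = \<nu>"
proof -
  interpret M: prob_space \<mu> using assms by (simp add: copula_law_def)
  interpret N: prob_space \<nu> using assms by (simp add: copula_law_def)
  have sets: "sets \<mu> = sets borel" "sets \<nu> = sets borel" using assms by (simp_all add: copula_law_def)
  let ?E = "range (\<lambda>p :: real \<times> real. {..p})"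
  have gen: "sets borel = sigma_sets UNIV ?E" by (subst borel_eq_atMost) simp
  show ?thesis
  proof (rule measure_eqI_generator_eq[where E = ?E and \<Omega> = UNIV
        and A = "\<lambda>i::nat. {..(real i, real i)}"])
    show "Int_stable ?E"
      unfolding Int_stable_def
    proof (intro ballI)
      fix A B assume "A \<in> ?E" "B \<in> ?E"
      then obtain p q where "A = {..p}" "B = {..q}" by blast
      then have "A \<inter> B = {..(min (fst p) (fst q), min (snd p) (snd q))}"
        by (auto simp: less_eq_prod_def)
      then show "A \<inter> B \<in> ?E" by blast
    qed
    show "(\<Union>i::nat. {..(real i, real i)}) = UNIV"
    proof (intro set_eqI iffI UNIV_I)
      fix p :: "real \<times> real"
      obtain i :: nat where "max (fst p) (snd p) \<le> real i" using real_arch_simple by blast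
      then have "p \<in> {..(real i, real i)}" by (simp add: less_eq_prod_def)
      then show "p \<in> (\<Union>i::nat. {..(real i, real i)})" by blast
    qed
    show "emeasure \<mu> X = emeasure \<nu> X" if "X \<in> ?E" for X
    proof -
      from that obtain u v where "X = {..(u, v)}" by auto
      then show ?thesis
        using measure_atMost_copula_law assms by (simp add: M.emeasure_eq_measure N.emeasure_eq_measure)
    qed
  qed (auto simp: sets gen)
qed

lemma copula_law_copula_measure: "copula_law (copula_measure C)"
proof -
  have "\<exists>!\<mu>. copula_law \<mu>" using copula_law_exists copula_law_unique by blast
  then have "copula_law (THE \<mu>. copula_law \<mu>)" by (rule theI')
  then show ?thesis by (simp add: copula_measure_def copula_law_def)
qed

end

section \<open>The footrule as an integral over the diagonal\<close>

lemma has_integral_affine: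
  fixes a b p q :: real
  assumes "a \<le> b"
  shows "((\<lambda>t. p * t + q) has_integral (p * (b\<^sup>2 - a\<^sup>2) / 2 + q * (b - a))) {a..b}"
proof -
  have "((\<lambda>t. p * t + q) has_integral ((p * b\<^sup>2 / 2 + q * b) - (p * a\<^sup>2 / 2 + q * a))) {a..b}"
    using assms
    by (intro fundamental_theorem_of_calculus)
      (auto intro!: derivative_eq_intros simp flip: has_real_derivative_iff_has_vector_derivative)
  then show ?thesis by (simp add: algebra_simps diff_divide_distrib)
qed

text \<open>The branches invert \<phi> = 24 d^2 - 12 d + 1 on [1/4, 1/3] and \<phi> = 1 - 12 d^2 on
  [0, 1/3]; both give 1/3 at \<phi> = -1/3.\<close>

definition asymmetry_bound :: "real \<Rightarrow> real" where
  "asymmetry_bound \<phi> =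
     (if \<phi> \<le> - 1 / 3 then (3 + sqrt (3 + 6 * \<phi>)) / 12 else sqrt ((1 - \<phi>) / 12))"

context copula_fun begin

definition diag_integral :: real where
  "diag_integral = integral {0..1} (\<lambda>t. C t t)"

lemma diag_lipschitz:
  assumes "0 \<le> s" "s \<le> t" "t \<le> 1"
  shows "C s s \<le> C t t" "C t t \<le> C s s + 2 * (t - s)"
  using increment_left[of s t s] increment_right[of t s t] increment_left[of s t t]
    increment_right[of s s t] assms by auto

lemma diag_continuous: "continuous_on {0..1} (\<lambda>t. C t t)"
proof -
  have "2-lipschitz_on {0..1} (\<lambda>t. C t t)"
  proof (rule lipschitz_onI)
    fix x y :: real assume "x \<in> {0..1}" "y \<in> {0..1}"
    then show "dist (C x x) (C y y) \<le> 2 * dist x y"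
      using diag_lipschitz[of x y] diag_lipschitz[of y x]
      by (cases "x \<le> y") (auto simp: dist_real_def abs_if)
  qed simp
  then show ?thesis by (rule lipschitz_on_continuous_on)
qed

lemma diag_integrable: "(\<lambda>t. C t t) integrable_on {0..1}"
  using diag_continuous by (rule integrable_continuous_real)

text \<open>Since \<open>min x y\<close> is the length of \<open>{t. 0 \<le> t < x \<and> t < y}\<close>, Fubini's theorem turns the
  expectation of \<open>min X Y\<close> into the integral of the survival function \<open>1 - 2 t + C t t\<close>
  along the diagonal.\<close>

lemma footrule_eq: "footrule C = 6 * diag_integral - 2"
proof -
  let ?\<mu> = "copula_measure C"
  have law: "copula_law ?\<mu>" by (rule copula_law_copula_measure)
  interpret prob_space ?\<mu> using law by (simp add: copula_law_def)
  have sets [measurable_cong]: "sets ?\<mu> = sets (borel \<Otimes>\<^sub>M borel)"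
    using law unfolding borel_prod by (simp add: copula_law_def)
  interpret pair_sigma_finite ?\<mu> lborel ..
  let ?S = "{0..1} \<times> {0..1} :: (real \<times> real) set"
  have S [measurable]: "?S \<in> sets (borel \<Otimes>\<^sub>M borel)" by measurable
  define T where "T = {(p, t). p \<in> ?S \<and> 0 \<le> t \<and> t \<le> 1 \<and> t < fst p \<and> t < snd p}"
  have T [measurable]: "T \<in> Sigma_Algebra.sets ((borel \<Otimes>\<^sub>M borel) \<Otimes>\<^sub>M borel)"
  proof -
    have "{x \<in> space ((borel \<Otimes>\<^sub>M borel) \<Otimes>\<^sub>M borel). fst x \<in> ?S \<and> 0 \<le> snd x \<and> snd x \<le> 1
        \<and> snd x < fst (fst x) \<and> snd x < snd (fst x)}
        \<in> Sigma_Algebra.sets ((borel \<Otimes>\<^sub>M borel) \<Otimes>\<^sub>M (borel :: real measure))"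
      by measurable
    also have "{x \<in> space ((borel \<Otimes>\<^sub>M borel) \<Otimes>\<^sub>M borel). fst x \<in> ?S \<and> 0 \<le> snd x \<and> snd x \<le> 1
        \<and> snd x < fst (fst x) \<and> snd x < snd (fst x)} = T"
      by (auto simp: T_def space_pair_measure)
    finally show ?thesis .
  qed
  have T': "T \<in> Sigma_Algebra.sets (?\<mu> \<Otimes>\<^sub>M lborel)"
    using T by (simp cong: sets_pair_measure_cong add: sets)
  have sub: "T \<subseteq> UNIV \<times> {0..1}" by (auto simp: T_def)
  \<comment> \<open>Lebesgue measure is infinite, so integrability for Fubini comes from enclosing
    \<open>T\<close> in a strip of finite measure.\<close>
  have "emeasure (?\<mu> \<Otimes>\<^sub>M lborel) T \<le> emeasure (?\<mu> \<Otimes>\<^sub>M lborel) (space ?\<mu> \<times> {0..1::real})"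
  proof (rule emeasure_mono)
    show "T \<subseteq> space ?\<mu> \<times> {0..1}"
      using sub sets_eq_imp_space_eq[OF sets] by (simp add: space_pair_measure)
    show "space ?\<mu> \<times> {0..1::real} \<in> Sigma_Algebra.sets (?\<mu> \<Otimes>\<^sub>M lborel)"
      by (intro pair_measureI) auto
  qed
  also have "\<dots> < \<infinity>"
    by (subst lborel.emeasure_pair_measure_Times) (auto simp: emeasure_space_1)
  finally have int: "integrable (?\<mu> \<Otimes>\<^sub>M lborel) (case_prod (\<lambda>p t. indicator T (p, t) :: real))"
    using T' by (simp add: case_prod_beta')
  have "(LINT p:?S|?\<mu>. copula_M (fst p) (snd p)) = (\<integral>p. (\<integral>t. indicator T (p, t) \<partial>lborel) \<partial>?\<mu>)"
    unfolding set_lebesgue_integral_def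
  proof (rule Bochner_Integration.integral_cong[OF refl])
    fix p :: "real \<times> real"
    show "indicator ?S p *\<^sub>R copula_M (fst p) (snd p) = (\<integral>t. indicator T (p, t) \<partial>lborel)"
    proof (cases "p \<in> ?S")
      case True
      then have "(\<lambda>t. indicator T (p, t) :: real) = indicator {0..<min (fst p) (snd p)}"
        by (auto simp: T_def indicator_def fun_eq_iff)
      then show ?thesis using True by (auto simp: copula_M_def)
    next
      case False
      then show ?thesis by (simp add: T_def)
    qed
  qed
  also have "\<dots> = (\<integral>t. (\<integral>p. indicator T (p, t) \<partial>?\<mu>) \<partial>lborel)"
    by (rule Fubini_integral[OF int, symmetric])
  also have "\<dots> = (LINT t:{0..1}|lborel. 1 - 2 * t + C t t)"
    unfolding set_lebesgue_integral_def
  proof (rule Bochner_Integration.integral_cong[OF refl])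
    fix t :: real
    have 1: "prob ({0..u} \<times> {0..v}) = C u v" if "0 \<le> u" "u \<le> 1" "0 \<le> v" "v \<le> 1" for u v
      using law that by (simp add: copula_law_def)
    have ev: "{0..u} \<times> {0..v} \<in> events" for u v by measurable
    show "(\<integral>p. indicator T (p, t) \<partial>?\<mu>) = indicator {0..1} t *\<^sub>R (1 - 2 * t + C t t)"
    proof (cases "t \<in> {0..1}")
      case True
      \<comment> \<open>Inclusion-exclusion: inside the square, the minimum of the coordinates is at
        most \<open>t\<close> exactly on the union of two strips of mass \<open>t\<close> whose
        intersection has mass \<open>C t t\<close>.\<close>
      have "{0..1} \<times> {0..t} \<inter> {0..t} \<times> {0..1} = {0..t} \<times> {0..t}" using True by auto
      then have u: "prob ({0..1} \<times> {0..t} \<union> {0..t} \<times> {0..1}) = 2 * t - C t t"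
        using True finite_measure_Union'[OF ev ev, of 1 t t 1]
          finite_measure_Diff'[OF ev ev, of t 1 1 t] by (simp add: 1 margins Int_commute)
      have "(\<lambda>p. indicator T (p, t) :: real)
          = indicator (?S - ({0..1} \<times> {0..t} \<union> {0..t} \<times> {0..1}))"
        using True by (auto simp: T_def indicator_def fun_eq_iff)
      then have "(\<integral>p. indicator T (p, t) \<partial>?\<mu>)
          = prob (?S - ({0..1} \<times> {0..t} \<union> {0..t} \<times> {0..1}))"
        using ev by simp
      also have "\<dots> = 1 - (2 * t - C t t)"
        using True ev by (subst finite_measure_Diff) (auto simp: 1 u margins)
      finally show ?thesis using True by simp
    next
      case False
      then show ?thesis by (auto simp: T_def)
    qed
  qed
  also have "\<dots> = integral {0..1} (\<lambda>t. 1 - 2 * t + C t t)"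
    by (intro set_borel_integral_eq_integral(2) borel_integrable_atLeastAtMost' continuous_intros
        diag_continuous)
  also have "\<dots> = integral {0..1} (\<lambda>t. 1 - 2 * t) + diag_integral"
    unfolding diag_integral_def
    by (intro integral_add diag_integrable integrable_continuous_real continuous_intros)
  \<comment> \<open>Hence the integral of \<open>min\<close> against dC is
    \<open>diag_integral\<close> itself.\<close>
  also have "integral {0..1} (\<lambda>t::real. 1 - 2 * t) = 0"
    using has_integral_affine[of 0 1 "-2" 1] by (intro integral_unique) simp
  finally show ?thesis by (simp add: footrule_def concordance_def)
qed

section \<open>Upper bounds for the asymmetry\<close>

lemma transpose_copula_fun: "copula_fun (\<lambda>u v. C v u)"
proof
  have "C v2 u2 - C v2 u1 - C v1 u2 + C v1 u1 \<ge> 0"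
    if "0 \<le> u1" "u1 \<le> u2" "u2 \<le> 1" "0 \<le> v1" "v1 \<le> v2" "v2 \<le> 1" for u1 u2 v1 v2
    using two_increasing[of v1 v2 u1 u2] that by simp
  then show "copula (\<lambda>u v. C v u)"
    by (auto simp: copula_def margins)
qed

lemma abs_diff_le_1:
  assumes "u \<in> {0..1}" "v \<in> {0..1}"
  shows "\<bar>C u v - C v u\<bar> \<le> 1"
  using assms frechet_bounds[of u v] frechet_bounds[of v u] by auto

lemma mu_infty_upper:
  assumes "u \<in> {0..1}" "v \<in> {0..1}"
  shows "\<bar>C u v - C v u\<bar> \<le> mu_infty C"
proof -
  have "bdd_above ((\<lambda>(u, v). \<bar>C u v - C v u\<bar>) ` ({0..1} \<times> {0..1}))"
    using abs_diff_le_1 by (auto intro!: bdd_aboveI[where M = 1])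
  from cSUP_upper[OF _ this, of "(u, v)"] assms show ?thesis
    by (simp add: mu_infty_def)
qed

lemma mu_infty_nonneg: "0 \<le> mu_infty C"
  using mu_infty_upper[of 0 0] by simp

lemma diag_integrable_on: "0 \<le> a \<Longrightarrow> b \<le> 1 \<Longrightarrow> (\<lambda>t. C t t) integrable_on {a..b}"
  by (rule integrable_subinterval_real[OF diag_integrable]) auto

lemma integral_diag_split:
  assumes "0 \<le> a" "a \<le> b" "b \<le> c" "c \<le> 1"
  shows "integral {a..c} (\<lambda>t. C t t) = integral {a..b} (\<lambda>t. C t t) + integral {b..c} (\<lambda>t. C t t)"
  using assms by (simp add: Henstock_Kurzweil_Integration.integral_combine diag_integrable_on)

lemma integral_diag_ge:
  assumes "0 \<le> a" "a \<le> b" "b \<le> 1" "\<And>t. a \<le> t \<Longrightarrow> t \<le> b \<Longrightarrow> p * t + q \<le> C t t"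
  shows "p * (b\<^sup>2 - a\<^sup>2) / 2 + q * (b - a) \<le> integral {a..b} (\<lambda>t. C t t)"
  using assms
  by (intro has_integral_le[OF has_integral_affine integrable_integral] diag_integrable_on) auto

lemma integral_diag_le:
  assumes "0 \<le> a" "a \<le> b" "b \<le> 1" "\<And>t. a \<le> t \<Longrightarrow> t \<le> b \<Longrightarrow> C t t \<le> p * t + q"
  shows "integral {a..b} (\<lambda>t. C t t) \<le> p * (b\<^sup>2 - a\<^sup>2) / 2 + q * (b - a)"
  using assms
  by (intro has_integral_le[OF integrable_integral has_integral_affine] diag_integrable_on) auto

lemma diag_ge:
  assumes "0 \<le> t" "t \<le> 1"
  shows "2 * t - 1 \<le> C t t"
  using frechet_bounds(4)[of t t] assms by simp

text \<open>Integrates the lower Frechet bound \<open>max 0 (2 * t - 1)\<close>. In terms of the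
  footrule this is its minimum -1/2.\<close>

lemma diag_integral_ge_quarter: "1 / 4 \<le> diag_integral"
proof -
  have "1 / 4 \<le> integral {1 / 2..1} (\<lambda>t. C t t)"
    using integral_diag_ge[of "1 / 2" 1 2 "-1"] diag_ge by (simp add: power2_eq_square)
  moreover have "0 \<le> integral {0..1 / 2} (\<lambda>t. C t t)"
    using integral_diag_ge[of 0 "1 / 2" 0 0] frechet_bounds(1) by simp
  ultimately show ?thesis
    unfolding diag_integral_def using integral_diag_split[of 0 "1 / 2" 1] by simp
qed

lemma asymmetry_geometry:
  assumes "0 \<le> a" "a \<le> b" "b \<le> 1"
  shows "C a b - C b a \<le> a - C b a" "C a b - C b a \<le> b - a" "a - C b a \<le> 1 - b"
  using frechet_bounds[of a b] frechet_bounds[of b a] increment_right(2)[of a a b]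
    increment_left(1)[of a b a] assms by auto

text \<open>The value \<open>e = C b a\<close> alone bounds the diagonal above by a continuous
  function with slopes 1, 0, 1, 2, 1 and breaks at \<open>e\<close>, \<open>a\<close>,
  \<open>b\<close>, \<open>b + p\<close>, where \<open>p = a - e\<close>.\<close>

lemma diag_integral_le_asymmetry:
  assumes ab: "0 \<le> a" "a \<le> b" "b \<le> 1" and nonneg: "0 \<le> C a b - C b a"
  shows "diag_integral \<le> 1 / 2 - 2 * (C a b - C b a)\<^sup>2"
proof -
  define e where "e = C b a"
  define p where "p = a - e"
  define D where "D = C a b - C b a"
  have e: "0 \<le> e" "e \<le> a" using ab frechet_bounds[of b a] by (simp_all add: e_def)
  have D: "0 \<le> D" "D \<le> p" "D \<le> b - a" "b + p \<le> 1"
    using nonneg asymmetry_geometry[of a b] ab by (auto simp: D_def p_def e_def)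
  have "integral {0..e} (\<lambda>t. C t t) \<le> e\<^sup>2 / 2"
    using integral_diag_le[of 0 e 1 0] frechet_bounds(2) e ab by simp
  moreover have "integral {e..a} (\<lambda>t. C t t) \<le> e * (a - e)"
  proof -
    have "C t t \<le> 0 * t + e" if "e \<le> t" "t \<le> a" for t
      using increment_left(1)[of t b t] increment_right(1)[of b t a] that e ab
      by (simp add: e_def)
    then show ?thesis using integral_diag_le[of e a 0 e] e ab by simp
  qed
  moreover have "integral {a..b} (\<lambda>t. C t t) \<le> (b\<^sup>2 - a\<^sup>2) / 2 - p * (b - a)"
  proof -
    have "C t t \<le> 1 * t + - p" if "a \<le> t" "t \<le> b" for t
      using increment_left(1)[of t b t] increment_right(2)[of b a t] that e ab
      by (simp add: e_def p_def)
    then show ?thesis using integral_diag_le[of a b 1 "- p"] e ab by simp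
  qed
  moreover have "integral {b..b + p} (\<lambda>t. C t t) \<le> (2 * (b + p)\<^sup>2 - 2 * b\<^sup>2) / 2 + (- p - b) * p"
  proof -
    have "C t t \<le> 2 * t + - (p + b)" if "b \<le> t" "t \<le> b + p" for t
      using increment_left(2)[of b t t] increment_right(2)[of b a t] that D ab
      by (simp add: e_def p_def)
    then show ?thesis using integral_diag_le[of b "b + p" 2 "- (p + b)"] D ab by simp
  qed
  moreover have "integral {b + p..1} (\<lambda>t. C t t) \<le> (1 - (b + p)\<^sup>2) / 2"
    using integral_diag_le[of "b + p" 1 1 0] frechet_bounds(2) D ab by simp
  moreover have "diag_integral = integral {0..e} (\<lambda>t. C t t) + integral {e..a} (\<lambda>t. C t t)
      + integral {a..b} (\<lambda>t. C t t) + integral {b..b + p} (\<lambda>t. C t t)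
      + integral {b + p..1} (\<lambda>t. C t t)"
    unfolding diag_integral_def
    using integral_diag_split[of 0 e 1] integral_diag_split[of e a 1] integral_diag_split[of a b 1]
      integral_diag_split[of b "b + p" 1] e ab D by simp
  \<comment> \<open>The area lost against the diagonal of \<open>min\<close> consists of two
    triangles of area \<open>p\<^sup>2 / 2\<close> and a parallelogram of area
    \<open>p * (b - a)\<close>.\<close>
  moreover have "e\<^sup>2 / 2 + e * (a - e) + ((b\<^sup>2 - a\<^sup>2) / 2 - p * (b - a))
      + ((2 * (b + p)\<^sup>2 - 2 * b\<^sup>2) / 2 + (- p - b) * p) + (1 - (b + p)\<^sup>2) / 2 = 1 / 2 - (p\<^sup>2 + p * (b - a))"
    unfolding p_def by (simp add: field_simps power2_eq_square)
  ultimately have "diag_integral \<le> 1 / 2 - (p\<^sup>2 + p * (b - a))" by linarith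
  moreover have "D\<^sup>2 \<le> p\<^sup>2" using D by (intro power_mono)
  moreover have "D\<^sup>2 \<le> p * (b - a)" unfolding power2_eq_square using D by (intro mult_mono) auto
  ultimately show ?thesis by (simp add: D_def)
qed

text \<open>Here \<open>C a b\<close> is at least \<open>D\<close>, and \<open>a\<close>,
  \<open>b - a\<close>, \<open>1 - b\<close> are all at least \<open>D\<close>, so
  \<open>D \<le> 1 / 3\<close>. The diagonal then lies above the maximum of 0,
  \<open>t - (1 - 2 * D)\<close> and \<open>2 * t - 1\<close>, whose breaks \<open>1 - 2 * D\<close>
  and \<open>2 * D\<close> are in this order because \<open>D \<ge> 1 / 4\<close>.\<close>

lemma diag_integral_ge_asymmetry:
  assumes ab: "0 \<le> a" "a \<le> b" "b \<le> 1" and quarter: "1 / 4 \<le> C a b - C b a"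
  shows "4 * (C a b - C b a)\<^sup>2 - 2 * (C a b - C b a) + 1 / 2 \<le> diag_integral"
proof -
  define D where "D = C a b - C b a"
  have e: "0 \<le> C b a" "a + b - 1 \<le> C b a" using ab frechet_bounds[of b a] by simp_all
  have D: "1 / 4 \<le> D" "D \<le> a - C b a" "D \<le> b - a" "a - C b a \<le> 1 - b"
    using quarter asymmetry_geometry[of a b] ab by (auto simp: D_def)
  then have third: "D \<le> 1 / 3" using e by simp
  have "0 \<le> integral {0..1 - 2 * D} (\<lambda>t. C t t)"
    using integral_diag_ge[of 0 "1 - 2 * D" 0 0] frechet_bounds(1) D third by simp
  moreover have "((2 * D)\<^sup>2 - (1 - 2 * D)\<^sup>2) / 2 + (2 * D - 1) * (4 * D - 1)
      \<le> integral {1 - 2 * D..2 * D} (\<lambda>t. C t t)"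
  proof -
    have "1 * t + - (1 - 2 * D) \<le> C t t" if t: "1 - 2 * D \<le> t" "t \<le> 2 * D" for t
    proof -
      \<comment> \<open>In each case \<open>C t t\<close> is reached from \<open>C a b\<close> by
        changing one coordinate at a time, losing at most the length of each decrease.\<close>
      consider "t \<le> a" | "a \<le> t" "t \<le> b" | "b \<le> t" by linarith
      then show ?thesis
      proof cases
        case 1
        then show ?thesis
          using increment_left(2)[of t a t] increment_right(2)[of a t b] t D e ab third
          by (simp add: D_def)
      next
        case 2
        then show ?thesis
          using increment_left(1)[of a t t] increment_right(2)[of a t b] t D e ab
          by (simp add: D_def)
      next
        case 3
        then show ?thesis
          using increment_left(1)[of a t t] increment_right(1)[of a b t] t D e ab third
          by (simp add: D_def)
      qed
    qed
    then show ?thesis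
      using integral_diag_ge[of "1 - 2 * D" "2 * D" 1 "- (1 - 2 * D)"] D third by simp
  qed
  moreover have "1 - (2 * D)\<^sup>2 - (1 - 2 * D) \<le> integral {2 * D..1} (\<lambda>t. C t t)"
    using integral_diag_ge[of "2 * D" 1 2 "-1"] diag_ge D third
    by (simp add: field_simps)
  moreover have "diag_integral = integral {0..1 - 2 * D} (\<lambda>t. C t t)
      + integral {1 - 2 * D..2 * D} (\<lambda>t. C t t) + integral {2 * D..1} (\<lambda>t. C t t)"
    unfolding diag_integral_def
    using integral_diag_split[of 0 "1 - 2 * D" 1] integral_diag_split[of "1 - 2 * D" "2 * D" 1]
      D third by simp
  moreover have "((2 * D)\<^sup>2 - (1 - 2 * D)\<^sup>2) / 2 + (2 * D - 1) * (4 * D - 1)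
      + (1 - (2 * D)\<^sup>2 - (1 - 2 * D)) = 4 * D\<^sup>2 - 2 * D + 1 / 2"
    by (simp add: field_simps power2_eq_square)
  ultimately show ?thesis
    unfolding D_def[symmetric] by linarith
qed

lemma asymmetry_le_bound:
  assumes ab: "0 \<le> a" "a \<le> b" "b \<le> 1" and nonneg: "0 \<le> C a b - C b a"
  shows "C a b - C b a \<le> asymmetry_bound (footrule C)"
proof (cases "footrule C \<le> - 1 / 3")
  case True
  define D where "D = C a b - C b a"
  have "12 * D - 3 \<le> sqrt (3 + 6 * footrule C)"
  proof (cases "1 / 4 \<le> D")
    case True
    then have "4 * D\<^sup>2 - 2 * D + 1 / 2 \<le> diag_integral"
      using diag_integral_ge_asymmetry[of a b] ab by (simp add: D_def)
    then have "(12 * D - 3)\<^sup>2 \<le> 3 + 6 * footrule C"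
      by (simp add: footrule_eq power2_eq_square algebra_simps)
    then show ?thesis by (rule real_le_rsqrt)
  next
    case False
    \<comment> \<open>\<open>sqrt\<close> is negative at negative arguments, so this rests on the
      footrule being at least -1/2.\<close>
    moreover have "0 \<le> sqrt (3 + 6 * footrule C)"
      using diag_integral_ge_quarter by (simp add: footrule_eq)
    ultimately show ?thesis by linarith
  qed
  then show ?thesis using True by (simp add: asymmetry_bound_def D_def)
next
  case False
  have "(C a b - C b a)\<^sup>2 \<le> (1 - footrule C) / 12"
    using diag_integral_le_asymmetry[of a b] assms by (simp add: footrule_eq)
  then show ?thesis using False by (simp add: asymmetry_bound_def real_le_rsqrt)
qed

text \<open>Transposition reverses the sign of the asymmetry and fixes the diagonal, hence the
  footrule; so the ordered pairs with nonnegative difference suffice.\<close>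

lemma mu_infty_le_bound: "mu_infty C \<le> asymmetry_bound (footrule C)"
proof -
  interpret T: copula_fun "\<lambda>u v. C v u" by (rule transpose_copula_fun)
  have T: "footrule (\<lambda>u v. C v u) = footrule C"
    by (simp add: footrule_eq T.footrule_eq diag_integral_def T.diag_integral_def)
  have *: "\<bar>C a b - C b a\<bar> \<le> asymmetry_bound (footrule C)" if "0 \<le> a" "a \<le> b" "b \<le> 1" for a b
    using asymmetry_le_bound[of a b] T.asymmetry_le_bound[of a b] that
    by (cases "0 \<le> C a b - C b a") (auto simp: T)
  have "\<bar>C u v - C v u\<bar> \<le> asymmetry_bound (footrule C)" if "u \<in> {0..1}" "v \<in> {0..1}" for u v
    using *[of u v] *[of v u] that by (cases "u \<le> v") (auto simp: abs_minus_commute)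
  then show ?thesis
    unfolding mu_infty_def by (intro cSUP_least) auto
qed

end

section \<open>Building blocks for the extremal copulas\<close>

definition two_increasing :: "(real \<Rightarrow> real \<Rightarrow> real) \<Rightarrow> bool" where
  "two_increasing H \<longleftrightarrow>
     (\<forall>u1 u2 v1 v2. u1 \<le> u2 \<longrightarrow> v1 \<le> v2 \<longrightarrow> 0 \<le> H u2 v2 - H u1 v2 - H u2 v1 + H u1 v1)"

text \<open>Each translated block of a shuffle of \<open>min\<close> contributes such a term, with
  \<open>f\<close> and \<open>g\<close> measuring how far \<open>u\<close> and \<open>v\<close> have
  advanced into the two sides of the block.\<close>

lemma two_increasing_min:
  assumes "mono f" "mono g"
  shows "two_increasing (\<lambda>u v. min (f u) (g v))"
  unfolding two_increasing_def
proof (intro allI impI)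
  fix u1 u2 v1 v2 :: real assume "u1 \<le> u2" "v1 \<le> v2"
  then have "f u1 \<le> f u2" "g v1 \<le> g v2" using assms by (simp_all add: monoD)
  then show "0 \<le> min (f u2) (g v2) - min (f u1) (g v2) - min (f u2) (g v1) + min (f u1) (g v1)"
    by (simp add: min_def)
qed

lemma two_increasing_lower: "two_increasing (\<lambda>u v. max 0 (u + v - 1))"
  by (auto simp: two_increasing_def max_def)

lemma two_increasing_add:
  assumes "two_increasing H" "two_increasing K"
  shows "two_increasing (\<lambda>u v. H u v + K u v)"
  unfolding two_increasing_def
proof (intro allI impI)
  fix u1 u2 v1 v2 :: real assume "u1 \<le> u2" "v1 \<le> v2"
  then have "0 \<le> H u2 v2 - H u1 v2 - H u2 v1 + H u1 v1"
    "0 \<le> K u2 v2 - K u1 v2 - K u2 v1 + K u1 v1"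
    using assms unfolding two_increasing_def by blast+
  then show "0 \<le> H u2 v2 + K u2 v2 - (H u1 v2 + K u1 v2) - (H u2 v1 + K u2 v1) + (H u1 v1 + K u1 v1)"
    by linarith
qed

lemma two_increasing_cmult:
  assumes "two_increasing H" "0 \<le> c"
  shows "two_increasing (\<lambda>u v. c * H u v)"
  unfolding two_increasing_def
proof (intro allI impI)
  fix u1 u2 v1 v2 :: real assume "u1 \<le> u2" "v1 \<le> v2"
  then have "0 \<le> c * (H u2 v2 - H u1 v2 - H u2 v1 + H u1 v1)"
    using assms unfolding two_increasing_def by simp
  then show "0 \<le> c * H u2 v2 - c * H u1 v2 - c * H u2 v1 + c * H u1 v1"
    by (simp add: algebra_simps)
qed

lemma copula_funI:
  assumes "two_increasing H"
    and "\<And>t. 0 \<le> t \<Longrightarrow> t \<le> 1 \<Longrightarrow> H t 0 = 0 \<and> H 0 t = 0 \<and> H t 1 = t \<and> H 1 t = t"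
  shows "copula_fun H"
  using assms by unfold_locales (auto simp: copula_def two_increasing_def)

lemma mono_clip:
  fixes c d :: real
  shows "mono (\<lambda>x. min x c)" "mono (\<lambda>x. max 0 (x - c))" "mono (\<lambda>x. max 0 (min (x - c) d))"
  by (auto intro!: monoI simp: min_def max_def)

section \<open>Attainment of both bounds\<close>

lemma symmetric_attained:
  assumes "- 1 / 2 \<le> \<phi>" "\<phi> \<le> 1"
  shows "\<exists>C. copula C \<and> footrule C = \<phi> \<and> mu_infty C = 0"
proof -
  \<comment> \<open>The footrule is affine in the copula and equals 1 at \<open>min\<close> and -1/2
    at the lower Frechet bound; \<open>c\<close> solves
    \<open>c - (1 - c) / 2 = \<phi>\<close>.\<close>
  define c where "c = (2 * \<phi> + 1) / 3"
  have c: "0 \<le> c" "c \<le> 1" using assms by (simp_all add: c_def)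
  define H where "H = (\<lambda>u v :: real. c * min u v + (1 - c) * max 0 (u + v - 1))"
  interpret copula_fun H
  proof (rule copula_funI)
    show "two_increasing H" unfolding H_def using c
      by (intro two_increasing_add two_increasing_cmult two_increasing_min two_increasing_lower)
        (auto intro: monoI)
  qed (auto simp: H_def algebra_simps)
  have "H t t = c * t + 0" if "0 \<le> t" "t \<le> 1 / 2" for t using that by (simp add: H_def)
  then have 1: "integral {0..1 / 2} (\<lambda>t. H t t) = c / 8"
    using integral_diag_le[of 0 "1 / 2" c 0] integral_diag_ge[of 0 "1 / 2" c 0]
    by (simp add: power2_eq_square)
  have "H t t = (2 - c) * t + (c - 1)" if "1 / 2 \<le> t" "t \<le> 1" for t
    using that by (simp add: H_def algebra_simps)
  then have 2: "integral {1 / 2..1} (\<lambda>t. H t t) = (2 - c) * 3 / 8 + (c - 1) / 2"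
    using integral_diag_le[of "1 / 2" 1 "2 - c" "c - 1"]
      integral_diag_ge[of "1 / 2" 1 "2 - c" "c - 1"]
    by (simp add: power2_eq_square)
  have "footrule H = \<phi>"
    unfolding footrule_eq diag_integral_def using integral_diag_split[of 0 "1 / 2" 1] 1 2
    by (simp add: c_def field_simps)
  moreover have "H u v = H v u" for u v by (simp add: H_def min.commute add.commute)
  then have "mu_infty H = 0" by (simp add: mu_infty_def)
  ultimately show ?thesis using copula by blast
qed

text \<open>The mass is spread uniformly along the graph that translates \<open>[0, 2d]\<close> onto \<open>[d, 3d]\<close> and
  \<open>[2d, 3d]\<close> onto \<open>[0, d]\<close>, and is the identity on \<open>[3d, 1]\<close>. All inequalities bounding the diagonal
  from above in terms of the asymmetry at \<open>(d, 2d)\<close> are then equalities.\<close>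

lemma large_footrule_attained:
  assumes d: "0 \<le> d" "d \<le> 1 / 3"
  shows "\<exists>C. copula C \<and> footrule C = 1 - 12 * d\<^sup>2 \<and> d \<le> mu_infty C"
proof -
  define H where "H = (\<lambda>u v :: real. min (min u (2 * d)) (max 0 (v - d))
    + min (max 0 (u - 2 * d)) (min v d) + min (max 0 (u - 3 * d)) (max 0 (v - 3 * d)))"
  interpret copula_fun H
  proof (rule copula_funI)
    show "two_increasing H" unfolding H_def
      by (intro two_increasing_add two_increasing_min mono_clip)
  qed (use d in \<open>auto simp: H_def min_def max_def\<close>)
  have pt: "H d (2 * d) = d" "H (2 * d) d = 0"
    using d by (simp_all add: H_def min_def max_def)
  have "0 \<le> integral {0..d} (\<lambda>t. H t t)"
    using integral_diag_ge[of 0 d 0 0] frechet_bounds(1) d by simp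
  moreover have "((2 * d)\<^sup>2 - d\<^sup>2) / 2 - d * d \<le> integral {d..2 * d} (\<lambda>t. H t t)"
    using integral_diag_ge[of d "2 * d" 1 "- d"] d by (simp add: H_def)
  moreover have "(3 * d)\<^sup>2 - (2 * d)\<^sup>2 - 3 * d * d \<le> integral {2 * d..3 * d} (\<lambda>t. H t t)"
    using integral_diag_ge[of "2 * d" "3 * d" 2 "- 3 * d"] d by (simp add: H_def)
  moreover have "(1 - (3 * d)\<^sup>2) / 2 \<le> integral {3 * d..1} (\<lambda>t. H t t)"
    using integral_diag_ge[of "3 * d" 1 1 0] d by (simp add: H_def)
  moreover have "diag_integral = integral {0..d} (\<lambda>t. H t t) + integral {d..2 * d} (\<lambda>t. H t t)
      + integral {2 * d..3 * d} (\<lambda>t. H t t) + integral {3 * d..1} (\<lambda>t. H t t)"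
    unfolding diag_integral_def
    using integral_diag_split[of 0 d 1] integral_diag_split[of d "2 * d" 1]
      integral_diag_split[of "2 * d" "3 * d" 1] d by simp
  moreover have "((2 * d)\<^sup>2 - d\<^sup>2) / 2 - d * d + ((3 * d)\<^sup>2 - (2 * d)\<^sup>2 - 3 * d * d)
      + (1 - (3 * d)\<^sup>2) / 2 = 1 / 2 - 2 * d\<^sup>2"
    by (simp add: field_simps power2_eq_square)
  \<comment> \<open>Only lower estimates of the integral were computed; the matching upper one is
    the general inequality at the point \<open>(d, 2 * d)\<close>.\<close>
  moreover have "diag_integral \<le> 1 / 2 - 2 * d\<^sup>2"
    using diag_integral_le_asymmetry[of d "2 * d"] d by (simp add: pt)
  ultimately have "footrule H = 1 - 12 * d\<^sup>2" unfolding footrule_eq by linarith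
  moreover have "d \<le> mu_infty H" using mu_infty_upper[of d "2 * d"] d by (simp add: pt)
  ultimately show ?thesis using copula by blast
qed

text \<open>The mass is spread uniformly along the graph that reverses the order of the intervals
  \<open>[0, 2d]\<close>, \<open>[2d, 1 - d]\<close>, \<open>[1 - d, 1]\<close> by translations. The asymmetry \<open>d\<close> occurs at
  \<open>(d, 1 - d)\<close>, where the bound of the diagonal from below is tight.\<close>

lemma small_footrule_attained:
  assumes d: "1 / 4 \<le> d" "d \<le> 1 / 3"
  shows "\<exists>C. copula C \<and> footrule C = 24 * d\<^sup>2 - 12 * d + 1 \<and> d \<le> mu_infty C"
proof -
  define H where "H = (\<lambda>u v :: real. min (min u (2 * d)) (max 0 (v - (1 - 2 * d)))
    + min (max 0 (min (u - 2 * d) (1 - 3 * d))) (max 0 (v - d))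
    + min (max 0 (u - (1 - d))) (min v d))"
  interpret copula_fun H
  proof (rule copula_funI)
    show "two_increasing H" unfolding H_def
      by (intro two_increasing_add two_increasing_min mono_clip)
  qed (use d in \<open>auto simp: H_def min_def max_def\<close>)
  have pt: "H d (1 - d) = d" "H (1 - d) d = 0"
    using d by (simp_all add: H_def min_def max_def)
  have "integral {0..1 - 2 * d} (\<lambda>t. H t t) \<le> 0"
    using integral_diag_le[of 0 "1 - 2 * d" 0 0] d by (simp add: H_def)
  moreover have "((2 * d)\<^sup>2 - (1 - 2 * d)\<^sup>2) / 2 + (2 * d - 1) * (4 * d - 1)
      \<ge> integral {1 - 2 * d..2 * d} (\<lambda>t. H t t)"
    using integral_diag_le[of "1 - 2 * d" "2 * d" 1 "2 * d - 1"] d by (simp add: H_def)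
  moreover have "1 - (2 * d)\<^sup>2 - (1 - 2 * d) \<ge> integral {2 * d..1} (\<lambda>t. H t t)"
  proof -
    have "H t t \<le> 2 * t + - 1" if "2 * d \<le> t" "t \<le> 1" for t
      using d that by (auto simp: H_def min_def max_def)
    then show ?thesis using integral_diag_le[of "2 * d" 1 2 "-1"] d by (simp add: field_simps)
  qed
  moreover have "diag_integral = integral {0..1 - 2 * d} (\<lambda>t. H t t)
      + integral {1 - 2 * d..2 * d} (\<lambda>t. H t t) + integral {2 * d..1} (\<lambda>t. H t t)"
    unfolding diag_integral_def
    using integral_diag_split[of 0 "1 - 2 * d" 1] integral_diag_split[of "1 - 2 * d" "2 * d" 1]
      d by simp
  moreover have "((2 * d)\<^sup>2 - (1 - 2 * d)\<^sup>2) / 2 + (2 * d - 1) * (4 * d - 1)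
      + (1 - (2 * d)\<^sup>2 - (1 - 2 * d)) = 4 * d\<^sup>2 - 2 * d + 1 / 2"
    by (simp add: field_simps power2_eq_square)
  \<comment> \<open>The computed estimates are upper ones; the general inequality at
    \<open>(d, 1 - d)\<close> closes the gap from below.\<close>
  moreover have "4 * d\<^sup>2 - 2 * d + 1 / 2 \<le> diag_integral"
    using diag_integral_ge_asymmetry[of d "1 - d"] d by (simp add: pt)
  ultimately have "footrule H = 24 * d\<^sup>2 - 12 * d + 1" unfolding footrule_eq by linarith
  moreover have "d \<le> mu_infty H" using mu_infty_upper[of d "1 - d"] d by (simp add: pt)
  ultimately show ?thesis using copula by blast
qed

text \<open>The shuffle parameter \<open>d\<close> is the bound itself. Its branches land in
  [1/4, 1/3] and [0, 1/3], the ranges in which the two shuffles are defined.\<close>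

lemma asymmetry_bound_attained:
  assumes "- 1 / 2 \<le> \<phi>" "\<phi> \<le> 1"
  shows "\<exists>C. copula C \<and> footrule C = \<phi> \<and> mu_infty C = asymmetry_bound \<phi>"
proof -
  define d where "d = asymmetry_bound \<phi>"
  have "\<exists>C. copula C \<and> footrule C = \<phi> \<and> d \<le> mu_infty C"
  proof (cases "\<phi> \<le> - 1 / 3")
    case True
    then have s: "sqrt (3 + 6 * \<phi>) = 12 * d - 3" by (simp add: d_def asymmetry_bound_def field_simps)
    have "sqrt (3 + 6 * \<phi>) \<le> 1" "0 \<le> sqrt (3 + 6 * \<phi>)" using True assms by simp_all
    then have "1 / 4 \<le> d" "d \<le> 1 / 3" unfolding s by simp_all
    moreover have "(12 * d - 3)\<^sup>2 = 3 + 6 * \<phi>" unfolding s[symmetric] using assms by simp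
    then have "24 * d\<^sup>2 - 12 * d + 1 = \<phi>" by (simp add: power2_eq_square algebra_simps)
    ultimately show ?thesis using small_footrule_attained[of d] by simp
  next
    case False
    then have s: "d = sqrt ((1 - \<phi>) / 12)" by (simp add: d_def asymmetry_bound_def)
    have "0 \<le> d" "d \<le> 1 / 3" unfolding s using False assms
      by (simp, intro real_le_lsqrt) (simp_all add: power2_eq_square)
    moreover have "d\<^sup>2 = (1 - \<phi>) / 12" unfolding s using assms by simp
    then have "1 - 12 * d\<^sup>2 = \<phi>" by simp
    ultimately show ?thesis using large_footrule_attained[of d] by simp
  qed
  then obtain C where C: "copula C" "footrule C = \<phi>" "d \<le> mu_infty C" by blast
  then interpret copula_fun C by unfold_locales
  \<comment> \<open>The shuffles only supply asymmetry at least \<open>d\<close>; the general bound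
    at footrule \<phi> excludes more.\<close>
  have "mu_infty C = d" using C mu_infty_le_bound by (simp add: d_def)
  then show ?thesis using C by (auto simp: d_def)
qed

theorem corollary16:
  fixes \<phi> :: real
  shows "(\<forall>C. copula C \<and> footrule C = \<phi> \<longrightarrow>
            0 \<le> mu_infty C \<and>
            mu_infty C \<le> (if \<phi> \<le> - 1 / 3 then (3 + sqrt (3 + 6 * \<phi>)) / 12
                           else sqrt ((1 - \<phi>) / 12))) \<and>
         (- 1 / 2 \<le> \<phi> \<and> \<phi> \<le> 1 \<longrightarrow>
            (\<exists>C. copula C \<and> footrule C = \<phi> \<and> mu_infty C = 0) \<and>
            (\<exists>C. copula C \<and> footrule C = \<phi> \<and>
               mu_infty C = (if \<phi> \<le> - 1 / 3 then (3 + sqrt (3 + 6 * \<phi>)) / 12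
                             else sqrt ((1 - \<phi>) / 12))))"
  unfolding asymmetry_bound_def[symmetric]
  using copula_fun.mu_infty_nonneg copula_fun.mu_infty_le_bound copula_fun.intro
    symmetric_attained asymmetry_bound_attained
  by blast

end
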